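(* Let $S$ be any $n\times n$ connectivity matrix of a pendulum tree, let $\ell,m\in\mathbb{R}_+^n$ and $g>0$, and let $$A=g\,\bigl[\operatorname{diag}(\ell)\,S^{T}\operatorname{diag}(m)\,S\,\operatorname{diag}(\ell)\bigr]^{-1}\operatorname{diag}(\ell\odot[S^{T}m])\in\mathbb{R}^{n\times n}.$$ Then the diagonal entries of $A^{-1}$ are $(A^{-1})_{kk}=\ell_k/g$ for $k=1,\dots,n$. In particular, the trace of $A^{-1}$ equals $\ell_{\rm tot}/g$, where $\ell_{\rm tot}=\sum_{k=1}^n\ell_k$. Hence the eigenfrequencies $\omega_1,\dots,\omega_n$ of the linearization $\ddot\theta=-A\theta$ satisfy $$\sum_{k=1}^n\frac{1}{\omega_k^2}=\frac{\ell_{\rm tot}}{g}.$$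
   Context: Notation: $\mathbb{R}_+$ denotes the positive reals; $\odot$ is the elementwise product of column vectors; $\operatorname{diag}(a)$ is the diagonal matrix with the entries of the vector $a$ on its diagonal. Connectivity matrix of a pendulum tree: a pendulum tree has arms $1,\dots,n$ ($n\ge1$); exactly one arm $r$ is attached at its near end to the fixed pivot, every other arm $k$ is attached at its near end to the tip of another arm $p(k)$ (its parent), and iterating $p$ from any arm eventually reaches $r$ (so there are no cycles). Its connectivity matrix $S\in\{0,1\}^{n\times n}$ has $S_{kj}=1$ if arm $j$ lies on the path from the pivot to the tip of arm $k$ (that is, $j=k$ or $j$ is obtained from $k$ by iterating $p$), and $S_{kj}=0$ otherwise. Such $S$ is invertible. The vectors $\ell$ and $m$ are the lengths of the arms and the masses at their tips. The differential equation $\ddot\theta=-A\theta$ is the linearization of the pendulum's equation of motion at the hanging position. The matrix $A$ is diagonalizable over $\mathbb{R}$ with $n$ positive real eigenvalues $\lambda_1,\dots,\lambda_n$ (counted with multiplicity), and the eigenfrequencies are $\omega_k=\sqrt{\lambda_k}$. *)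

theory Defs
  imports "HOL-Analysis.Analysis" "HOL-Computational_Algebra.Computational_Algebra"
begin

text \<open>
  The arms are the elements of the finite index type. The map \<^term>\<open>p\<close> sends an arm to its
  parent; it is \<^term>\<open>None\<close> exactly at the arm \<open>r\<close> that hangs from the fixed pivot.
\<close>

definition parent_rel :: "('n \<Rightarrow> 'n option) \<Rightarrow> ('n \<times> 'n) set" where
  "parent_rel p = {(k, j). p k = Some j}"

definition pendulum_tree :: "('n::finite \<Rightarrow> 'n option) \<Rightarrow> bool" where
  "pendulum_tree p \<longleftrightarrow>
     (\<exists>r. p r = None \<and>
          (\<forall>k. k \<noteq> r \<longrightarrow> (\<exists>j. j \<noteq> k \<and> p k = Some j)) \<and>
          (\<forall>k. (k, r) \<in> (parent_rel p)\<^sup>*))"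

definition connectivity_matrix :: "('n::finite \<Rightarrow> 'n option) \<Rightarrow> real ^ 'n ^ 'n" where
  "connectivity_matrix p = (\<chi> k j. if (k, j) \<in> (parent_rel p)\<^sup>* then 1 else 0)"

definition is_connectivity_matrix :: "real ^ 'n ^ 'n \<Rightarrow> bool" where
  "is_connectivity_matrix S \<longleftrightarrow> (\<exists>p. pendulum_tree p \<and> S = connectivity_matrix p)"

definition diag :: "real ^ 'n \<Rightarrow> real ^ 'n ^ 'n" where
  "diag a = (\<chi> i j. if i = j then a $ i else 0)"

text \<open>In the last factor, \<open>*\<close> on vectors is the elementwise product.\<close>

definition pendulum_matrix ::
    "real ^ 'n ^ 'n \<Rightarrow> real ^ 'n \<Rightarrow> real ^ 'n \<Rightarrow> real \<Rightarrow> real ^ 'n ^ 'n" where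
  "pendulum_matrix S l m g =
     g *\<^sub>R (matrix_inv (diag l ** transpose S ** diag m ** S ** diag l)
           ** diag (l * (transpose S *v m)))"

definition charpoly :: "'a::comm_ring_1 ^ 'n ^ 'n \<Rightarrow> 'a poly" where
  "charpoly A = det (\<chi> i j. (if i = j then [:0, 1:] else 0) - [:A $ i $ j:])"

text \<open>
  The real eigenvalues with their algebraic multiplicities. This multiset has as many elements
  as the matrix has rows precisely when the characteristic polynomial splits over the reals.
\<close>

definition eigenvalues :: "real ^ 'n ^ 'n \<Rightarrow> real multiset" where
  "eigenvalues A = proots (charpoly A)"

text \<open>
  The eigenfrequencies of \<open>\<theta>'' = -A \<theta>\<close>. Only meaningful if all eigenvalues are positive:
  \<^const>\<open>sqrt\<close> is an odd function on all of the reals.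
\<close>

definition eigenfrequencies :: "real ^ 'n ^ 'n \<Rightarrow> real multiset" where
  "eigenfrequencies A = image_mset sqrt (eigenvalues A)"

end

theory Submission
  imports Defs
begin

no_notation fps_nth (infixl \<open>$\<close> 75)

text \<open>
  Write \<open>M = diag l S\<^sup>T diag m S diag l\<close> and \<open>D = diag (l \<odot> S\<^sup>T m)\<close>, so that
  \<open>A\<^sup>-\<^sup>1 = g\<^sup>-\<^sup>1 D\<^sup>-\<^sup>1 M\<close>. Since the entries of \<open>S\<close> are idempotent, the \<open>k\<close>-th diagonal entry of \<open>M\<close>
  is \<open>l\<^sub>k\<^sup>2 (S\<^sup>T m)\<^sub>k\<close>, which is \<open>l\<^sub>k\<close> times that of \<open>D\<close>. For the spectrum, \<open>A\<^sup>-\<^sup>1\<close> is similar to the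
  symmetric positive definite matrix \<open>g\<^sup>-\<^sup>1 D\<^sup>-\<^sup>1\<^sup>/\<^sup>2 M D\<^sup>-\<^sup>1\<^sup>/\<^sup>2\<close>, hence to a positive diagonal matrix, and
  the sum of its eigenvalues is its trace.
\<close>

section \<open>The spectral theorem\<close>

text \<open>Near \<open>t = 0\<close> the linear term dominates, so a nonzero \<open>a\<close> would
  force negative values for small \<open>t\<close> of opposite sign. This serves as the first-order
  condition at a maximizer.\<close>

lemma quadratic_nonneg_imp_linear_coeff_zero:
  fixes a b :: real
  assumes "\<And>t. 0 \<le> 2 * t * a + t\<^sup>2 * b"
  shows "a = 0"
proof (rule ccontr)
  assume "a \<noteq> 0"
  \<comment> \<open>Any positive \<open>c\<close> with \<open>b < 2 * c\<close> makes
    \<open>t = - a / c\<close> a counterexample.\<close>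
  define c where "c = \<bar>b\<bar> + 1"
  have c: "c > 0" "b < c" by (auto simp: c_def)
  have "0 \<le> 2 * (- a / c) * a + (- a / c)\<^sup>2 * b" by (rule assms)
  also have "\<dots> = (a\<^sup>2 / c\<^sup>2) * (b - 2 * c)"
    using c by (simp add: field_simps power2_eq_square)
  also have "\<dots> < 0"
    using c \<open>a \<noteq> 0\<close> by (intro mult_pos_neg) auto
  finally show False by simp
qed

text \<open>Variational argument: a maximizer of \<open>x \<bullet> f x\<close> on the unit sphere
  of \<open>V\<close> exists by compactness and is an eigenvector, its eigenvalue being the
  maximum.\<close>

lemma selfadjoint_eigenvector_exists:
  fixes f :: "'a::euclidean_space \<Rightarrow> 'a"
  assumes f: "linear f" and sym: "\<And>x y. f x \<bullet> y = x \<bullet> f y"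
    and V: "subspace V" "V \<noteq> {0}" and inv: "\<And>x. x \<in> V \<Longrightarrow> f x \<in> V"
  shows "\<exists>v\<in>V. norm v = 1 \<and> (\<exists>c. f v = c *\<^sub>R v)"
proof -
  let ?S = "V \<inter> sphere 0 1"
  have "compact ?S"
    using V(1) by (intro closed_Int_compact closed_subspace compact_sphere)
  moreover have "?S \<noteq> {}"
  proof -
    obtain x where x: "x \<in> V" "x \<noteq> 0" using V subspace_0 by blast
    then have "x /\<^sub>R norm x \<in> ?S" using V(1) by (simp add: subspace_scale)
    then show ?thesis by blast
  qed
  moreover have "continuous_on ?S (\<lambda>x. x \<bullet> f x)"
    using f by (intro continuous_intros linear_continuous_on linear_conv_bounded_linear[THEN iffD1])
  ultimately obtain v where v: "v \<in> ?S" and max: "\<And>x. x \<in> ?S \<Longrightarrow> x \<bullet> f x \<le> v \<bullet> f v"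
    by (metis continuous_attains_sup)
  define c where "c = v \<bullet> f v"
  have vv: "v \<bullet> v = 1" using v by (simp add: norm_eq_1)
  have Rayleigh: "x \<bullet> f x \<le> c * (x \<bullet> x)" if "x \<in> V" for x
  proof (cases "x = 0")
    case False
    then have "x /\<^sub>R norm x \<in> ?S" using V(1) that by (simp add: subspace_scale)
    from max[OF this] have "(x \<bullet> f x) / (norm x)\<^sup>2 \<le> c"
      by (simp add: linear_scale[OF f] c_def field_simps power2_eq_square)
    then show ?thesis using False by (simp add: field_simps power2_norm_eq_inner)
  qed (simp add: linear_0[OF f])
  \<comment> \<open>The form \<open>c * (x \<bullet> x) - x \<bullet> f x\<close> is nonnegative on
    \<open>V\<close> and vanishes at \<open>v\<close>; its expansion at
    \<open>v + t *\<^sub>R w\<close> has no constant term.\<close>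
  have stationary: "w \<bullet> (c *\<^sub>R v - f v) = 0" if w: "w \<in> V" for w
  proof (rule quadratic_nonneg_imp_linear_coeff_zero)
    fix t
    have "v + t *\<^sub>R w \<in> V" using v w V(1) by (simp add: subspace_add subspace_scale)
    note Rayleigh[OF this]
    then show "0 \<le> 2 * t * (w \<bullet> (c *\<^sub>R v - f v)) + t\<^sup>2 * (c * (w \<bullet> w) - w \<bullet> f w)"
      using sym[of v w]
      by (simp add: linear_add[OF f] linear_scale[OF f] inner_add inner_diff_right vv
          inner_commute[of v w] inner_commute[of "f v" w] c_def[symmetric] algebra_simps power2_eq_square)
  qed
  \<comment> \<open>By invariance the residual is itself an admissible direction, hence orthogonal
    to itself.\<close>
  have "c *\<^sub>R v - f v \<in> V" using v inv V(1) by (simp add: subspace_diff subspace_scale)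
  from stationary[OF this] have "f v = c *\<^sub>R v" by simp
  with v show ?thesis by auto
qed

text \<open>Split off an eigenvector \<open>v\<close> and induct on its orthogonal complement in
  \<open>V\<close>, which is invariant because \<open>f\<close> is self-adjoint. The induction is
  why \<open>V\<close> need not be the whole space.\<close>

lemma selfadjoint_orthonormal_eigenbasis:
  fixes f :: "'a::euclidean_space \<Rightarrow> 'a"
  assumes f: "linear f" and sym: "\<And>x y. f x \<bullet> y = x \<bullet> f y"
    and V: "subspace V" and inv: "\<And>x. x \<in> V \<Longrightarrow> f x \<in> V"
  shows "\<exists>B. pairwise orthogonal B \<and> span B = V \<and> (\<forall>b\<in>B. norm b = 1 \<and> (\<exists>c. f b = c *\<^sub>R b))"
  using V inv
proof (induction "dim V" arbitrary: V rule: less_induct)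
  case less
  show ?case
  proof (cases "V = {0}")
    case True
    then show ?thesis by (intro exI[of _ "{}"]) auto
  next
    case False
    obtain v c where v: "v \<in> V" "norm v = 1" "f v = c *\<^sub>R v"
      using selfadjoint_eigenvector_exists[OF f sym less.prems(1) False less.prems(2)] by blast
    define W where "W = {x \<in> V. v \<bullet> x = 0}"
    have W: "subspace W"
      using less.prems(1) by (auto simp: W_def subspace_def inner_add)
    have "v \<notin> W" using v by (simp add: W_def norm_eq_1)
    moreover have "W \<subseteq> V" by (auto simp: W_def)
    ultimately have "W \<subset> V" using v(1) by blast
    then have "dim W < dim V"
      using W less.prems(1) by (intro dim_psubset) (simp add: span_eq_iff[THEN iffD2])
    moreover have "f x \<in> W" if "x \<in> W" for x
      using that less.prems(2) sym[of v x] v by (simp add: W_def)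
    ultimately obtain B where B: "pairwise orthogonal B" "span B = W"
      "\<forall>b\<in>B. norm b = 1 \<and> (\<exists>c. f b = c *\<^sub>R b)"
      using less.hyps[of W] W by blast
    have BW: "b \<in> W" if "b \<in> B" for b using that B(2) span_base by blast
    have "pairwise orthogonal (insert v B)"
      using B(1) BW by (auto simp: pairwise_insert W_def orthogonal_def inner_commute)
    moreover have "span (insert v B) = V"
    proof
      show "span (insert v B) \<subseteq> V"
        using v BW less.prems(1) by (intro span_minimal) (auto simp: W_def)
      show "V \<subseteq> span (insert v B)"
      proof
        fix x assume "x \<in> V"
        then have "x - (v \<bullet> x) *\<^sub>R v \<in> span B"
          unfolding B(2) using v less.prems(1)
          by (simp add: W_def inner_diff_right subspace_diff subspace_scale norm_eq_1)
        then show "x \<in> span (insert v B)" by (auto simp: span_insert)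
      qed
    qed
    ultimately show ?thesis using v B(3) by (intro exI[of _ "insert v B"]) auto
  qed
qed

section \<open>Diagonal matrices and orthogonal diagonalization\<close>

lemma diag_mult_nth: "(diag a ** X) $ i $ j = a $ i * X $ i $ j"
  by (simp add: diag_def matrix_matrix_mult_def if_distrib[of "\<lambda>x. x * _"] cong: if_cong)

lemma mult_diag_nth: "(X ** diag a) $ i $ j = X $ i $ j * a $ j"
  by (simp add: diag_def matrix_matrix_mult_def if_distrib cong: if_cong)

lemma diag_mult_diag: "diag a ** diag b = diag (a * b)"
  by (simp add: vec_eq_iff diag_mult_nth) (simp add: diag_def)

lemma diag_eq_mat_1:
  fixes a :: "real ^ 'n"
  shows "(\<And>i. a $ i = 1) \<Longrightarrow> diag a = mat 1"
  by (simp add: vec_eq_iff diag_def mat_def)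

lemma transpose_diag: "transpose (diag a) = diag a"
  by (simp add: vec_eq_iff diag_def transpose_def)

lemma symmetric_matrix_diagonalization:
  fixes N :: "real ^ 'n ^ 'n"
  assumes "transpose N = N"
  obtains Q :: "real ^ 'n ^ 'n" and c where "transpose Q ** Q = mat 1" "Q ** transpose Q = mat 1" "N ** Q = Q ** diag c"
proof -
  have "(N *v x) \<bullet> y = x \<bullet> (N *v y)" for x y
    using dot_lmul_matrix[of x N y] assms transpose_matrix_vector[of N x] by simp
  then obtain B where B: "pairwise orthogonal B" "span B = (UNIV :: (real^'n) set)"
      "\<forall>b\<in>B. norm b = 1 \<and> (\<exists>c. N *v b = c *\<^sub>R b)"
    using selfadjoint_orthonormal_eigenbasis[of "(*v) N" UNIV] by auto
  have "independent B" using B by (intro pairwise_orthogonal_independent) auto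
  then have "finite B" "card B = CARD('n)"
    using B(2) dim_span_eq_card_independent[of B] by (auto simp: independent_imp_finite)
  then obtain q where q: "bij_betw q (UNIV :: 'n set) B"
    using finite_same_card_bij[of "UNIV :: 'n set" B] by auto
  then have qB: "q i \<in> B" for i by (auto simp: bij_betw_def)
  have "\<forall>i. \<exists>c. N *v q i = c *\<^sub>R q i" using B(3) qB by blast
  then obtain c where c: "N *v q i = c i *\<^sub>R q i" for i using choice by metis
  define Q where "Q = (\<chi> i j. q j $ i)"
  have col: "column j Q = q j" for j by (simp add: Q_def column_def vec_eq_iff)
  have "orthogonal_matrix Q"
    unfolding orthogonal_matrix_orthonormal_columns col
    using B(1,3) qB bij_betw_imp_inj_on[OF q] by (simp add: pairwise_def inj_eq)
  moreover have "N ** Q = Q ** diag (\<chi> i. c i)"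
  proof -
    have "(N ** Q) $ i $ j = (N *v q j) $ i" for i j
      by (simp add: matrix_matrix_mult_def matrix_vector_mult_def Q_def)
    then show ?thesis by (simp add: vec_eq_iff c mult_diag_nth Q_def)
  qed
  ultimately show ?thesis using that by (auto simp: orthogonal_matrix_def)
qed

section \<open>Characteristic polynomials and inverses\<close>

text \<open>Embedding matrices as constant polynomial matrices respects products, so the
  characteristic matrix is conjugated along with \<open>A\<close>, and the determinant is
  multiplicative.\<close>

lemma charpoly_similar:
  fixes A P Q :: "'a::comm_ring_1 ^ 'n ^ 'n"
  assumes "P ** Q = mat 1"
  shows "charpoly (P ** A ** Q) = charpoly A"
proof -
  define C :: "'a ^ 'n ^ 'n \<Rightarrow> 'a poly ^ 'n ^ 'n" where "C = (\<lambda>B. \<chi> i j. [:B $ i $ j:])"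
  define X :: "'a poly ^ 'n ^ 'n" where "X = (\<chi> i j. if i = j then [:0, 1:] else 0)"
  have char: "charpoly B = det (X - C B)" for B
    by (simp add: charpoly_def C_def X_def minus_vec_def)
  have const_add: "[:a + b:] = [:a:] + [:b:]" for a b :: 'a by simp
  have const_sum: "[:sum f T:] = (\<Sum>k\<in>T. [:f k:])" for f :: "'n \<Rightarrow> 'a" and T
    by (induction T rule: infinite_finite_induct) (simp_all add: const_add del: add_pCons)
  have C_mult: "C (B ** B') = C B ** C B'" for B B'
    by (simp add: C_def matrix_matrix_mult_def vec_eq_iff const_sum mult.commute)
  have PQ: "C P ** C Q = mat 1"
    unfolding C_mult[symmetric] assms by (simp add: C_def mat_def vec_eq_iff)
  \<comment> \<open>\<open>X\<close> is the indeterminate times the identity, hence central.\<close>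
  have "X ** B = B ** X" for B
    by (simp add: X_def matrix_matrix_mult_def vec_eq_iff if_distrib if_distribR mult.commute cong: if_cong)
  then have "C P ** X ** C Q = X"
    by (metis PQ matrix_mul_assoc matrix_mul_rid)
  moreover have "C P ** (X - C A) ** C Q = C P ** X ** C Q - C (P ** A ** Q)"
    unfolding C_mult
    by (simp add: matrix_matrix_mult_def vec_eq_iff algebra_simps sum_subtractf sum_distrib_left)
  ultimately have "X - C (P ** A ** Q) = C P ** (X - C A) ** C Q" by simp
  then have "charpoly (P ** A ** Q) = det (C P ** C Q) * det (X - C A)"
    by (simp add: char det_mul mult_ac)
  then show ?thesis by (simp add: PQ char)
qed

lemma eigenvalues_diag: "eigenvalues (diag (a :: real ^ 'n)) = image_mset (($) a) (mset_set UNIV)"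
proof -
  have "charpoly (diag a) = (\<Prod>i\<in>UNIV. [:- a $ i, 1:])"
    unfolding charpoly_def by (subst det_diagonal) (auto simp: diag_def)
  then have "eigenvalues (diag a) = (\<Sum>i\<in>UNIV. {#a $ i#})"
    by (simp add: eigenvalues_def proots_prod)
  also have "\<dots> = image_mset (($) a) (mset_set UNIV)"
    by (simp add: sum_unfold_sum_mset)
  finally show ?thesis .
qed

lemma matrix_inv_right:
  fixes A :: "'a::semiring_1 ^ 'n ^ 'm"
  assumes "invertible A"
  shows "A ** matrix_inv A = mat 1"
  using someI_ex[OF assms[unfolded invertible_def]] by (simp add: matrix_inv_def)

lemma matrix_inv_eqI:
  fixes A B :: "'a::field ^ 'n ^ 'n"
  assumes "B ** A = mat 1"
  shows "invertible A" "matrix_inv A = B"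
proof -
  show "invertible A" using assms invertible_left_inverse by blast
  then have "A ** matrix_inv A = mat 1" by (rule matrix_inv_right)
  then show "matrix_inv A = B"
    by (metis assms matrix_mul_assoc matrix_mul_lid matrix_mul_rid)
qed

lemma invertible_diag:
  fixes a :: "real ^ 'n"
  assumes "\<And>i. a $ i \<noteq> 0"
  shows "invertible (diag a)"
  unfolding invertible_left_inverse
  by (rule exI[of _ "diag (\<chi> i. 1 / a $ i)"]) (simp add: assms diag_mult_diag diag_eq_mat_1)

text \<open>The Gram matrix of an invertible \<open>W\<close> is symmetric positive definite. The
  witness \<open>c\<close> lists its eigenvalues, which conjugation by \<open>E\<close> passes on to
  \<open>matrix_inv A\<close>; those of \<open>A\<close> are the reciprocals.\<close>

lemma spectrum_of_inverse_similar_gram: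
  fixes A E E' W :: "real ^ 'n ^ 'n"
  assumes A: "invertible A" and W: "invertible W" and E: "E ** E' = mat 1"
    and inv: "matrix_inv A = E ** (transpose W ** W) ** E'"
  shows "\<exists>c :: 'n \<Rightarrow> real. (\<forall>i. c i > 0) \<and> eigenvalues A = image_mset (\<lambda>i. 1 / c i) (mset_set UNIV) \<and>
    trace (matrix_inv A) = (\<Sum>i\<in>UNIV. c i)"
proof -
  let ?N = "transpose W ** W"
  obtain Q :: "real ^ 'n ^ 'n" and c where Q: "transpose Q ** Q = mat 1" "Q ** transpose Q = mat 1"
      and c: "?N ** Q = Q ** diag c"
    using symmetric_matrix_diagonalization[of ?N] by (auto simp: matrix_transpose_mul)
  have E': "E' ** E = mat 1" using E matrix_left_right_inverse by blast
  define P R where "P = E ** Q" and "R = transpose Q ** E'"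
  have PR: "P ** R = mat 1" and RP: "R ** P = mat 1"
    unfolding P_def R_def using E E' Q by (metis matrix_mul_assoc matrix_mul_rid)+
  have K: "matrix_inv A = P ** diag c ** R"
    unfolding inv P_def R_def using c Q(2) by (metis matrix_mul_assoc matrix_mul_rid)
  \<comment> \<open>The eigenvalue is the squared norm of the image under \<open>W\<close> of the
    unit eigenvector \<open>column i Q\<close>.\<close>
  have pos: "c $ i > 0" for i
  proof -
    let ?x = "W *v column i Q"
    have "column i Q \<bullet> column i Q = (transpose Q ** Q) $ i $ i"
      by (simp add: matrix_mult_transpose_dot_column)
    then have "column i Q \<noteq> 0"
      using Q(1) by (auto simp: mat_def)
    then have "?x \<noteq> 0"
      using inj_matrix_vector_mult[OF W] by (metis injD matrix_vector_mult_0_right)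
    moreover have "?x \<bullet> ?x = c $ i"
    proof -
      have "c $ i = (transpose Q ** (?N ** Q)) $ i $ i"
        unfolding c by (simp add: matrix_mul_assoc Q(1)) (simp add: diag_def)
      also have "\<dots> = (transpose (W ** Q) ** (W ** Q)) $ i $ i"
        by (simp add: matrix_transpose_mul matrix_mul_assoc)
      also have "\<dots> = column i (W ** Q) \<bullet> column i (W ** Q)"
        by (simp add: matrix_mult_transpose_dot_column)
      also have "column i (W ** Q) = ?x"
        by (simp add: vec_eq_iff column_def matrix_matrix_mult_def matrix_vector_mult_def)
      finally show ?thesis by simp
    qed
    ultimately show ?thesis by (metis inner_gt_zero_iff)
  qed
  let ?d = "\<chi> i. 1 / c $ i"
  have "diag c ** diag ?d = mat 1"
    using pos by (simp add: diag_mult_diag diag_eq_mat_1 less_imp_neq[THEN not_sym])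
  then have "matrix_inv A ** (P ** diag ?d ** R) = mat 1"
    unfolding K using PR RP by (metis matrix_mul_assoc matrix_mul_rid)
  then have "A = P ** diag ?d ** R"
    using matrix_inv_right[OF A] by (metis matrix_mul_assoc matrix_mul_lid matrix_mul_rid)
  then have "eigenvalues A = eigenvalues (diag ?d)"
    using charpoly_similar[OF PR] by (simp add: eigenvalues_def)
  moreover have "trace (matrix_inv A) = trace (diag c)"
    unfolding K using RP
    by (metis matrix_mul_assoc matrix_mul_lid trace_mul_sym)
  moreover have "eigenvalues (diag ?d) = image_mset (\<lambda>i. 1 / c $ i) (mset_set UNIV)"
    unfolding eigenvalues_diag by (intro image_mset_cong) simp
  moreover have "trace (diag c) = (\<Sum>i\<in>UNIV. c $ i)"
    by (simp add: trace_def diag_def)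
  ultimately show ?thesis
    using pos by (intro exI[of _ "($) c"]) simp
qed

section \<open>Connectivity matrices\<close>

text \<open>Induction along the path to the root: the root has no parent, and since parents are
  unique, a cycle through \<open>k\<close> would also be a cycle through its parent.\<close>

lemma pendulum_tree_acyclic:
  assumes "pendulum_tree p"
  shows "(k, k) \<notin> (parent_rel p)\<^sup>+"
proof -
  from assms obtain r where r: "p r = None" "(k, r) \<in> (parent_rel p)\<^sup>*"
    unfolding pendulum_tree_def by blast
  from r(2) show ?thesis
  proof (induction rule: converse_rtrancl_induct)
    case base
    then show ?case using r(1) by (auto simp: parent_rel_def dest: tranclD)
  next
    case (step k j)
    show ?case
    proof
      assume "(k, k) \<in> (parent_rel p)\<^sup>+"
      then obtain j' where "(k, j') \<in> parent_rel p" "(j', k) \<in> (parent_rel p)\<^sup>*"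
        by (blast dest: tranclD)
      with step have "(j, k) \<in> (parent_rel p)\<^sup>*" by (auto simp: parent_rel_def)
      with step show False by (blast intro: rtrancl_into_trancl1)
    qed
  qed
qed

text \<open>The paths of an arm \<open>k\<close> and of its parent differ by \<open>k\<close> only, so the corresponding rows of the
  matrix differ by the \<open>k\<close>-th unit vector.\<close>

lemma connectivity_matrix_invertible:
  fixes S :: "real ^ 'n ^ 'n"
  assumes "is_connectivity_matrix S"
  shows "invertible S"
proof -
  obtain p where p: "pendulum_tree p" and S: "S = connectivity_matrix p"
    using assms by (auto simp: is_connectivity_matrix_def)
  define up where "up k = {j. (k, j) \<in> (parent_rel p)\<^sup>*}" for k
  have Sx: "(S *v x) $ k = sum (($) x) (up k)" for x k
    by (simp add: S connectivity_matrix_def matrix_vector_mult_def up_def if_distrib[of "\<lambda>z. z * _"]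
        sum.If_cases cong: if_cong)
  \<comment> \<open>For \<open>x\<close> in the kernel, the sums over all paths vanish; subtracting
    the parent's sum isolates a single entry.\<close>
  have "x = 0" if "S *v x = 0" for x
  proof -
    have sum0: "sum (($) x) (up k) = 0" for k using that Sx by (metis zero_index)
    have "x $ k = 0" for k
    proof (cases "p k")
      case None
      then have "up k = {k}"
        by (auto simp: up_def parent_rel_def elim: converse_rtranclE)
      then show ?thesis using sum0[of k] by simp
    next
      case (Some j)
      then have kj: "(k, j) \<in> parent_rel p" by (simp add: parent_rel_def)
      have "up k = insert k (up j)"
        using Some kj by (auto simp: up_def parent_rel_def elim: converse_rtranclE
            intro: converse_rtrancl_into_rtrancl)
      moreover have "k \<notin> up j"
        using pendulum_tree_acyclic[OF p, of k] kj by (auto simp: up_def intro: rtrancl_into_trancl2)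
      ultimately show ?thesis using sum0[of k] sum0[of j] by simp
    qed
    then show ?thesis by (simp add: vec_eq_iff)
  qed
  then show ?thesis by (simp add: invertible_left_inverse matrix_left_invertible_ker)
qed

section \<open>Inverse and spectrum of the pendulum matrix\<close>

theorem lemma5p2:
  fixes S A :: "real ^ 'n ^ 'n" and l m :: "real ^ 'n" and g :: real
  assumes S: "is_connectivity_matrix S"
    and l: "\<forall>k. l $ k > 0"
    and m: "\<forall>k. m $ k > 0"
    and g: "g > 0"
    and A: "A = pendulum_matrix S l m g"
  shows "invertible A
    \<and> (\<forall>k. matrix_inv A $ k $ k = l $ k / g)
    \<and> trace (matrix_inv A) = (\<Sum>k\<in>UNIV. l $ k) / g
    \<and> size (eigenvalues A) = CARD('n)
    \<and> (\<forall>x\<in>#eigenvalues A. x > 0)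
    \<and> (\<Sum>\<omega>\<in>#eigenfrequencies A. 1 / \<omega>\<^sup>2) = (\<Sum>k\<in>UNIV. l $ k) / g"
proof -
  have S01: "S $ i $ j * S $ i $ j = S $ i $ j" "S $ i $ j \<ge> 0" "S $ i $ i = 1" for i j
    using S by (auto simp: is_connectivity_matrix_def connectivity_matrix_def)
  define s where "s = transpose S *v m"
  have s: "s $ k = (\<Sum>j\<in>UNIV. S $ j $ k * m $ j)" for k
    by (simp add: s_def matrix_vector_mult_def transpose_def del: transpose_matrix_vector)
  \<comment> \<open>Every arm lies on its own path, so the summand \<open>j = k\<close> is
    \<open>m $ k\<close>.\<close>
  have s_pos: "s $ k > 0" for k
    unfolding s using S01(2) S01(3)[of k] m
    by (intro sum_pos2[of _ k]) (auto simp: less_imp_le)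
  \<comment> \<open>\<open>diag e\<close> is the inverse square root of
    \<open>g *\<^sub>R diag (l * s)\<close>, so the factor \<open>g\<close> is absorbed too.\<close>
  define e where "e = (\<chi> k. 1 / sqrt (g * (l $ k * s $ k)))"
  have e_pos: "e $ k > 0" and e_sq: "e $ k * e $ k = 1 / (g * (l $ k * s $ k))" for k
    using l g s_pos[of k] by (auto simp: e_def intro!: abs_of_pos mult_pos_pos)
  \<comment> \<open>Distributing the square roots of the masses makes \<open>M\<close> the Gram
    matrix of \<open>F\<close>, and the symmetrized inverse \<open>diag e ** M ** diag e\<close>
    that of \<open>W\<close>.\<close>
  define F where "F = diag (\<chi> k. sqrt (m $ k)) ** S ** diag l"
  define W where "W = F ** diag e"
  define M where "M = diag l ** transpose S ** diag m ** S ** diag l"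
  have "diag m = diag (\<chi> k. sqrt (m $ k)) ** diag (\<chi> k. sqrt (m $ k))"
    unfolding diag_mult_diag using m
    by (intro arg_cong[of _ _ diag]) (simp add: vec_eq_iff less_imp_le)
  then have M: "M = transpose F ** F"
    by (simp add: M_def F_def matrix_transpose_mul transpose_diag matrix_mul_assoc)
  have F_inv: "invertible F"
    unfolding F_def using l m connectivity_matrix_invertible[OF S]
    by (intro invertible_mult invertible_diag) (auto simp: less_imp_neq[THEN not_sym])
  then have M_inv: "invertible M" unfolding M by (intro invertible_mult transpose_invertible)
  have W_inv: "invertible W"
    unfolding W_def using F_inv e_pos
    by (intro invertible_mult invertible_diag) (auto simp: less_imp_neq[THEN not_sym])
  \<comment> \<open>The candidate for the inverse; being square, a left inverse suffices.\<close>
  define K where "K = diag e ** diag e ** M"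
  have "K ** A = mat 1"
  proof -
    have "K ** A = g *\<^sub>R (diag e ** diag e ** (M ** matrix_inv M) ** diag (l * s))"
      by (simp add: K_def A pendulum_matrix_def M_def[symmetric] s_def[symmetric]
          matrix_scalar_ac scalar_matrix_assoc matrix_mul_assoc del: transpose_matrix_vector)
    also have "\<dots> = g *\<^sub>R diag (e * e * (l * s))"
      by (simp add: matrix_inv_right[OF M_inv] diag_mult_diag)
    also have "\<dots> = mat 1"
      using e_sq l g s_pos
      by (auto simp: vec_eq_iff diag_def mat_def less_imp_neq[THEN not_sym])
    finally show ?thesis .
  qed
  note A_inv = matrix_inv_eqI[OF this]
  have diag_M: "M $ k $ k = l $ k * l $ k * s $ k" for k
    by (simp add: M_def mult_diag_nth s sum_distrib_left)
       (simp add: matrix_matrix_mult_def[of _ S] mult_diag_nth diag_mult_nth transpose_def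
         sum_distrib_left sum_distrib_right S01(1) mult_ac)
  have diag_K: "K $ k $ k = l $ k / g" for k
    using e_sq[of k] l g s_pos[of k]
    by (simp add: K_def diag_mult_diag diag_mult_nth diag_M less_imp_neq[THEN not_sym])
  then have trace_K: "trace K = (\<Sum>k\<in>UNIV. l $ k) / g"
    by (simp add: trace_def sum_divide_distrib)
  let ?E' = "diag (\<chi> k. 1 / e $ k)"
  have EE': "diag e ** ?E' = mat 1"
    using e_pos by (simp add: diag_mult_diag diag_eq_mat_1 less_imp_neq[THEN not_sym])
  have gram: "matrix_inv A = diag e ** (transpose W ** W) ** ?E'"
  proof -
    have "diag e ** (transpose W ** W) ** ?E' = diag e ** diag e ** M ** (diag e ** ?E')"
      by (simp add: W_def M matrix_transpose_mul transpose_diag matrix_mul_assoc)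
    then show ?thesis by (simp add: EE' A_inv(2) K_def)
  qed
  obtain c :: "'n \<Rightarrow> real" where c: "\<forall>i. c i > 0"
    "eigenvalues A = image_mset (\<lambda>i. 1 / c i) (mset_set UNIV)"
    "trace (matrix_inv A) = (\<Sum>i\<in>UNIV. c i)"
    using spectrum_of_inverse_similar_gram[OF A_inv(1) W_inv EE' gram] by blast
  \<comment> \<open>Positivity lets the square undo the root, so the frequency sum becomes the trace
    of \<open>matrix_inv A\<close>.\<close>
  have "1 / (sqrt (1 / c i))\<^sup>2 = c i" for i
    using spec[OF c(1), of i] real_sqrt_pow2[of "1 / c i"] by auto
  then have "(\<Sum>\<omega>\<in>#eigenfrequencies A. 1 / \<omega>\<^sup>2) = (\<Sum>i\<in>UNIV. c i)"
    unfolding eigenfrequencies_def c(2) sum_unfold_sum_mset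
    by (simp only: image_mset.compositionality comp_def)
  then show ?thesis
    using A_inv diag_K trace_K c by auto
qed

end
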